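(* Let $\Omega,\Lambda\subset\mathbb{R}^n$ be bounded open sets with $\Lambda$ convex, and let $f\in C^{0,\alpha}(\overline\Omega)$, $g\in C^{0,\alpha}(\overline\Lambda)$ be positive functions bounded away from zero and infinity with $\int_\Omega f\,dx=\int_\Lambda g\,dx$. Let $\{x_j\}_{j=1}^N$, $\{S_i\}_{i=1}^M$ be an almost-triangulation of $\overline\Omega$, and let $\{\psi_j,\eta_j\}_{j=1}^N$ be a solution of the associated LDMAOP or of the associated DMAOP. Then the map $T:\{x_j\}\to\{\eta_j\}$ given by $x_j\mapsto\eta_j$ solves the Monge problem (for the quadratic cost) with source $\mu_D=\sum_{j=1}^N\delta_{x_j}$ and target $\nu_D=\sum_{j=1}^N\delta_{\eta_j}$; that is, $T_\#\mu_D=\nu_D$ and $T$ minimizes $\sum_{j=1}^N|T'(x_j)-x_j|^2$ among all maps $T'$ with $T'_\#\mu_D=\nu_D$.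
   Context: $\delta_p$ is the Dirac measure at $p$. **Almost-triangulation.** Points $x_1,\dots,x_N\in\overline\Omega$ and $n$-dimensional simplices $S_1,\dots,S_M\subset\overline\Omega$ whose set of vertices is exactly $\{x_j\}_{j=1}^N$, such that any two of the $S_i$ intersect in the empty set or a common face (of any dimension), and $\overline\Omega\setminus\bigcup_iS_i$ has "small" volume (an informal requirement). The vertices of $S_i$ are $x_{i_0},\dots,x_{i_n}$, and $V_i=\mathrm{vol}(S_i)$. Given $\eta_1,\dots,\eta_N\in\mathbb{R}^n$, let $A_i$ (resp. $B_i$) be the $n\times n$ matrix whose $j$-th row is $(x_{i_j}-x_{i_0})^T$ (resp. $(\eta_{i_j}-\eta_{i_0})^T$), $j=1,\dots,n$, and $H_i=\frac12A_i^{-1}B_i+\frac12(A_i^{-1}B_i)^T$. **LDMAOP.** Minimize over $\{\psi_i\in\mathbb{R},\eta_i\in\mathbb{R}^n\}_{i=1}^N$ the cost $$\sum_{i=1}^M V_i\max\Big\{0,-\log\det H_i-\log g\Big(\tfrac{1}{n+1}\sum_{j=0}^n\eta_{i_j}\Big)+\log f\Big(\tfrac1{n+1}\sum_{j=0}^nx_{i_j}\Big)\Big\}$$ subject to $\psi_j\ge\psi_i+\langle\eta_i,x_j-x_i\rangle$ for all $i,j=1,\dots,N$; $\eta_i\in\overline\Lambda$ for all $i=1,\dots,N$; and $H_i>0$ (positive definite) for all $i=1,\dots,M$. **DMAOP.** The same, with the cost replaced by $$\sum_{i=1}^M V_i\max\Big\{0,-(\det H_i)^{1/n}+\Big(f\Big(\tfrac1{n+1}\sum_{j=0}^nx_{i_j}\Big)\Big/g\Big(\tfrac{1}{n+1}\sum_{j=0}^n\eta_{i_j}\Big)\Big)^{1/n}\Big\}$$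 and the last constraint replaced by $H_i\ge0$ (positive semidefinite). A solution is a minimizer. *)

theory Defs
  imports "HOL-Probability.Probability"
begin

definition holder_continuous_on :: "real \<Rightarrow> 'a::metric_space set \<Rightarrow> ('a \<Rightarrow> real) \<Rightarrow> bool" where
  "holder_continuous_on \<alpha> K f \<longleftrightarrow>
     (\<exists>C. \<forall>x\<in>K. \<forall>y\<in>K. \<bar>f x - f y\<bar> \<le> C * dist x y powr \<alpha>)"

definition bounded_away_zero_infinity_on :: "'a set \<Rightarrow> ('a \<Rightarrow> real) \<Rightarrow> bool" where
  "bounded_away_zero_infinity_on K f \<longleftrightarrow> (\<exists>c>0. \<exists>C. \<forall>x\<in>K. c \<le> f x \<and> f x \<le> C)"

definition positive_semidefinite :: "real^'n^'n \<Rightarrow> bool" where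
  "positive_semidefinite H \<longleftrightarrow> transpose H = H \<and> (\<forall>u. 0 \<le> u \<bullet> (H *v u))"

definition positive_definite :: "real^'n^'n \<Rightarrow> bool" where
  "positive_definite H \<longleftrightarrow> transpose H = H \<and> (\<forall>u. u \<noteq> 0 \<longrightarrow> 0 < u \<bullet> (H *v u))"

text \<open>
  Points and simplices are indexed by \<open>{1..N}\<close> and \<open>{1..M}\<close>; values of the indexing functions
  outside these ranges play no role. The requirement that the uncovered part of the closure of
  \<open>\<Omega>\<close> has small volume is expressed with an explicit tolerance \<open>\<epsilon>\<close>.
\<close>

definition almost_triangulation ::
  "real \<Rightarrow> (real^'n) set \<Rightarrow> nat \<Rightarrow> (nat \<Rightarrow> real^'n) \<Rightarrow> nat \<Rightarrow> (nat \<Rightarrow> (real^'n) set) \<Rightarrow> bool"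
where
  "almost_triangulation \<epsilon> \<Omega> N x M S \<longleftrightarrow>
     inj_on x {1..N} \<and> x ` {1..N} \<subseteq> closure \<Omega> \<and>
     (\<forall>i\<in>{1..M}. int CARD('n) simplex S i \<and> S i \<subseteq> closure \<Omega>) \<and>
     (\<Union>i\<in>{1..M}. {p. p extreme_point_of S i}) = x ` {1..N} \<and>
     triangulation (S ` {1..M}) \<and>
     measure lebesgue (closure \<Omega> - (\<Union>i\<in>{1..M}. S i)) \<le> \<epsilon>"

text \<open>
  A labelling \<open>v\<close> names the vertices of each simplex: \<open>v i None\<close> is the index \<open>i\<^sub>0\<close> of the
  base vertex, and \<open>v i (Some j)\<close>, for \<open>j\<close> in the index type \<open>'n\<close> of the coordinates, are the
  indices of the other \<open>n\<close> vertices. Thus \<open>'n option\<close> plays the role of \<open>{0,...,n}\<close>, and the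
  edge matrices below are square matrices over \<open>'n\<close>.
\<close>

definition vertex_labelling ::
  "nat \<Rightarrow> (nat \<Rightarrow> real^'n) \<Rightarrow> nat \<Rightarrow> (nat \<Rightarrow> (real^'n) set) \<Rightarrow> (nat \<Rightarrow> 'n option \<Rightarrow> nat) \<Rightarrow> bool"
where
  "vertex_labelling N x M S v \<longleftrightarrow>
     (\<forall>i\<in>{1..M}. range (v i) \<subseteq> {1..N} \<and>
        bij_betw (\<lambda>j. x (v i j)) UNIV {p. p extreme_point_of S i})"

definition edge_matrix :: "(nat \<Rightarrow> real^'n) \<Rightarrow> ('n option \<Rightarrow> nat) \<Rightarrow> real^'n^'n" where
  "edge_matrix y w = (\<chi> j. y (w (Some j)) - y (w None))"

definition vertex_mean :: "(nat \<Rightarrow> real^'n) \<Rightarrow> ('n option \<Rightarrow> nat) \<Rightarrow> real^'n" where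
  "vertex_mean y w = (1 / (real CARD('n) + 1)) *\<^sub>R (\<Sum>j\<in>UNIV. y (w j))"

definition discrete_hessian ::
  "(nat \<Rightarrow> real^'n) \<Rightarrow> (nat \<Rightarrow> real^'n) \<Rightarrow> ('n option \<Rightarrow> nat) \<Rightarrow> real^'n^'n"
where
  "discrete_hessian x \<eta> w =
     (let A = edge_matrix x w; B = edge_matrix \<eta> w
      in (1/2) *\<^sub>R (matrix_inv A ** B) + (1/2) *\<^sub>R transpose (matrix_inv A ** B))"

definition LDMAOP_cost ::
  "(real^'n \<Rightarrow> real) \<Rightarrow> (real^'n \<Rightarrow> real) \<Rightarrow> (nat \<Rightarrow> real^'n) \<Rightarrow> nat \<Rightarrow> (nat \<Rightarrow> (real^'n) set) \<Rightarrow>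
   (nat \<Rightarrow> 'n option \<Rightarrow> nat) \<Rightarrow> (nat \<Rightarrow> real^'n) \<Rightarrow> real"
where
  "LDMAOP_cost f g x M S v \<eta> =
     (\<Sum>i=1..M. measure lebesgue (S i) *
        max 0 (- ln (det (discrete_hessian x \<eta> (v i)))
               - ln (g (vertex_mean \<eta> (v i))) + ln (f (vertex_mean x (v i)))))"

definition DMAOP_cost ::
  "(real^'n \<Rightarrow> real) \<Rightarrow> (real^'n \<Rightarrow> real) \<Rightarrow> (nat \<Rightarrow> real^'n) \<Rightarrow> nat \<Rightarrow> (nat \<Rightarrow> (real^'n) set) \<Rightarrow>
   (nat \<Rightarrow> 'n option \<Rightarrow> nat) \<Rightarrow> (nat \<Rightarrow> real^'n) \<Rightarrow> real"
where
  "DMAOP_cost f g x M S v \<eta> =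
     (\<Sum>i=1..M. measure lebesgue (S i) *
        max 0 (- (det (discrete_hessian x \<eta> (v i)) powr (1 / real CARD('n)))
               + (f (vertex_mean x (v i)) / g (vertex_mean \<eta> (v i))) powr (1 / real CARD('n))))"

definition LDMAOP_feasible ::
  "(real^'n) set \<Rightarrow> nat \<Rightarrow> (nat \<Rightarrow> real^'n) \<Rightarrow> nat \<Rightarrow> (nat \<Rightarrow> 'n option \<Rightarrow> nat) \<Rightarrow>
   (nat \<Rightarrow> real) \<Rightarrow> (nat \<Rightarrow> real^'n) \<Rightarrow> bool"
where
  "LDMAOP_feasible \<Lambda> N x M v \<psi> \<eta> \<longleftrightarrow>
     (\<forall>i\<in>{1..N}. \<forall>j\<in>{1..N}. \<psi> j \<ge> \<psi> i + \<eta> i \<bullet> (x j - x i)) \<and>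
     (\<forall>i\<in>{1..N}. \<eta> i \<in> closure \<Lambda>) \<and>
     (\<forall>i\<in>{1..M}. positive_definite (discrete_hessian x \<eta> (v i)))"

definition DMAOP_feasible ::
  "(real^'n) set \<Rightarrow> nat \<Rightarrow> (nat \<Rightarrow> real^'n) \<Rightarrow> nat \<Rightarrow> (nat \<Rightarrow> 'n option \<Rightarrow> nat) \<Rightarrow>
   (nat \<Rightarrow> real) \<Rightarrow> (nat \<Rightarrow> real^'n) \<Rightarrow> bool"
where
  "DMAOP_feasible \<Lambda> N x M v \<psi> \<eta> \<longleftrightarrow>
     (\<forall>i\<in>{1..N}. \<forall>j\<in>{1..N}. \<psi> j \<ge> \<psi> i + \<eta> i \<bullet> (x j - x i)) \<and>
     (\<forall>i\<in>{1..N}. \<eta> i \<in> closure \<Lambda>) \<and>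
     (\<forall>i\<in>{1..M}. positive_semidefinite (discrete_hessian x \<eta> (v i)))"

definition LDMAOP_solution where
  "LDMAOP_solution f g \<Lambda> N x M S v \<psi> \<eta> \<longleftrightarrow>
     LDMAOP_feasible \<Lambda> N x M v \<psi> \<eta> \<and>
     (\<forall>\<psi>' \<eta>'. LDMAOP_feasible \<Lambda> N x M v \<psi>' \<eta>' \<longrightarrow>
        LDMAOP_cost f g x M S v \<eta> \<le> LDMAOP_cost f g x M S v \<eta>')"

definition DMAOP_solution where
  "DMAOP_solution f g \<Lambda> N x M S v \<psi> \<eta> \<longleftrightarrow>
     DMAOP_feasible \<Lambda> N x M v \<psi> \<eta> \<and>
     (\<forall>\<psi>' \<eta>'. DMAOP_feasible \<Lambda> N x M v \<psi>' \<eta>' \<longrightarrow>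
        DMAOP_cost f g x M S v \<eta> \<le> DMAOP_cost f g x M S v \<eta>')"

text \<open>
  Dirac measures are taken on the sigma-algebra of all subsets. Then every map is measurable, so
  a map that matters only on finitely many atoms needs no Borel extension.
\<close>

definition dirac :: "'a \<Rightarrow> 'a measure" where
  "dirac p = return (count_space UNIV) p"

definition dirac_sum :: "nat \<Rightarrow> (nat \<Rightarrow> 'a) \<Rightarrow> 'a measure" where
  "dirac_sum N p = measure_of UNIV UNIV (\<lambda>E. \<Sum>j=1..N. emeasure (dirac (p j)) E)"

lemma space_dirac_sum [simp]: "space (dirac_sum N p) = UNIV"
  by (simp add: dirac_sum_def space_measure_of_conv)

lemma sets_dirac_sum [simp]: "sets (dirac_sum N p) = UNIV"
proof -
  have "sigma_sets UNIV (UNIV :: 'a set set) = UNIV"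
    by (auto intro: sigma_sets.Basic)
  then show ?thesis
    unfolding dirac_sum_def by (simp add: sets_measure_of_conv)
qed

lemma emeasure_dirac_sum: "emeasure (dirac_sum N p) E = (\<Sum>j=1..N. indicator E (p j))"
proof -
  have [simp]: "emeasure (dirac q) F = indicator F q" for q :: 'a and F
    by (simp add: dirac_def)
  have "emeasure (dirac_sum N p) E = (\<Sum>j=1..N. emeasure (dirac (p j)) E)"
  proof (rule emeasure_measure_of[OF dirac_sum_def])
    show "countably_additive (sets (dirac_sum N p)) (\<lambda>E. \<Sum>j=1..N. emeasure (dirac (p j)) E)"
    proof (rule countably_additiveI)
      fix F :: "nat \<Rightarrow> 'a set" assume "disjoint_family F"
      then have "(\<Sum>i. emeasure (dirac (p j)) (F i)) = emeasure (dirac (p j)) (\<Union>i. F i)" for j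
        by (intro suminf_emeasure) (auto simp: dirac_def)
      then show "(\<Sum>i. \<Sum>j=1..N. emeasure (dirac (p j)) (F i)) =
                 (\<Sum>j=1..N. emeasure (dirac (p j)) (\<Union>i. F i))"
        by (subst suminf_sum) (auto intro: sum.cong)
    qed
  qed (auto simp: positive_def)
  then show ?thesis by simp
qed

definition solves_quadratic_monge ::
  "'a::real_normed_vector measure \<Rightarrow> 'a measure \<Rightarrow> ('a \<Rightarrow> 'a) \<Rightarrow> bool"
where
  "solves_quadratic_monge \<mu> \<nu> T \<longleftrightarrow>
     T \<in> measurable \<mu> \<nu> \<and> distr \<mu> \<nu> T = \<nu> \<and>
     (\<forall>T'\<in>measurable \<mu> \<nu>. distr \<mu> \<nu> T' = \<nu> \<longrightarrow>
        (\<integral>\<^sup>+ p. ennreal ((norm (T p - p))\<^sup>2) \<partial>\<mu>) \<le> (\<integral>\<^sup>+ p. ennreal ((norm (T' p - p))\<^sup>2) \<partial>\<mu>))"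

end

theory Submission
  imports Defs
begin

text \<open>
  A map transporting \<open>\<mu>\<^sub>D\<close> to \<open>\<nu>\<^sub>D\<close> sends \<open>x j\<close> to \<open>\<eta> (\<sigma> j)\<close> for some permutation \<open>\<sigma>\<close>. Summing the
  constraints \<open>\<psi> j \<ge> \<psi> i + \<eta> i \<bullet> (x j - x i)\<close> with \<open>i = \<sigma> j\<close>, the values of \<open>\<psi>\<close> cancel, which gives
  \<open>(\<Sum>j. \<eta> (\<sigma> j) \<bullet> x j) \<le> (\<Sum>j. \<eta> j \<bullet> x j)\<close>; and this sum is the only part of the quadratic cost that
  depends on \<open>\<sigma>\<close>.
\<close>

text \<open>Both sides give \<open>E\<close> the number of indices \<open>j\<close> with
  \<open>p j \<in> E\<close>. Written as a pushforward of counting measure, \<open>dirac_sum\<close>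
  inherits the general rules for \<open>distr\<close> and \<open>count_space\<close>.\<close>

lemma dirac_sum_eq_distr:
  "dirac_sum N p = distr (count_space {1..N}) (count_space UNIV) p"
proof (rule measure_eqI)
  fix E :: "'a set"
  have "(\<Sum>j=1..N. indicator E (p j) :: ennreal) = of_nat (card (p -` E \<inter> {1..N}))"
    by (simp add: indicator_def sum.If_cases vimage_def Int_commute)
  then show "emeasure (dirac_sum N p) E
      = emeasure (distr (count_space {1..N}) (count_space UNIV) p) E"
    by (simp add: emeasure_dirac_sum emeasure_distr)
qed simp

lemma measurable_dirac_sum: "T \<in> measurable (dirac_sum N p) (dirac_sum K q)"
  by (simp add: measurable_def)

lemma distr_dirac_sum: "distr (dirac_sum N p) (dirac_sum K q) T = dirac_sum N (\<lambda>j. T (p j))"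
proof -
  \<comment> \<open>The target of \<open>distr\<close> matters only through its space and its sets,
    which agree here.\<close>
  have "distr (dirac_sum N p) (dirac_sum K q) T = distr (dirac_sum N p) (count_space UNIV) T"
    by (rule distr_cong) simp_all
  then show ?thesis
    by (simp add: dirac_sum_eq_distr distr_distr comp_def)
qed

lemma nn_integral_dirac_sum: "(\<integral>\<^sup>+ y. h y \<partial>dirac_sum N p) = (\<Sum>j=1..N. h (p j))"
  by (simp add: dirac_sum_eq_distr nn_integral_distr nn_integral_count_space_finite)

text \<open>The mass of \<open>{y}\<close> is the number of indices sent to \<open>y\<close>. Equal
  measures thus give equal multisets of values, and these differ only by a rearrangement of the
  indices. Working with multisets allows repeated points.\<close>

lemma dirac_sum_eq_imp_permutes:
  assumes "dirac_sum N p = dirac_sum N q"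
  obtains \<sigma> where "\<sigma> permutes {1..N}" "\<And>j. j \<in> {1..N} \<Longrightarrow> p j = q (\<sigma> j)"
proof -
  have count: "of_nat (count (image_mset r (mset_set {1..N})) y) = emeasure (dirac_sum N r) {y}"
    for r :: "nat \<Rightarrow> 'a" and y
    by (simp add: dirac_sum_eq_distr emeasure_distr count_image_mset)
  have "image_mset p (mset_set {1..N}) = image_mset q (mset_set {1..N})"
  proof (rule multiset_eqI)
    fix y
    have "(of_nat (count (image_mset p (mset_set {1..N})) y) :: ennreal)
        = of_nat (count (image_mset q (mset_set {1..N})) y)"
      unfolding count assms ..
    then show "count (image_mset p (mset_set {1..N})) y = count (image_mset q (mset_set {1..N})) y"
      by (simp only: of_nat_eq_iff)
  qed
  then show thesis
    using that by (rule image_mset_eq_implies_permutes[rotated]) auto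
qed

text \<open>This is cyclical monotonicity of subgradients, in its form for permutations.\<close>

lemma subgradients_quadratic_cost_le:
  fixes x \<eta> :: "'i \<Rightarrow> 'a::real_inner"
  assumes sub: "\<And>i j. i \<in> I \<Longrightarrow> j \<in> I \<Longrightarrow> \<psi> i + \<eta> i \<bullet> (x j - x i) \<le> \<psi> j"
    and perm: "\<sigma> permutes I"
  shows "(\<Sum>j\<in>I. (norm (\<eta> j - x j))\<^sup>2) \<le> (\<Sum>j\<in>I. (norm (\<eta> (\<sigma> j) - x j))\<^sup>2)"
proof -
  have reindex: "(\<Sum>j\<in>I. h (\<sigma> j)) = (\<Sum>j\<in>I. h j)" for h :: "'i \<Rightarrow> real"
    using sum.permute[OF perm, of h] by (simp add: comp_def)
  have "(\<Sum>j\<in>I. \<psi> (\<sigma> j) + (\<eta> (\<sigma> j) \<bullet> x j - \<eta> (\<sigma> j) \<bullet> x (\<sigma> j))) \<le> (\<Sum>j\<in>I. \<psi> j)"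
    using sub perm by (intro sum_mono) (auto simp: permutes_in_image simp flip: inner_diff_right)
  then have "(\<Sum>j\<in>I. \<eta> (\<sigma> j) \<bullet> x j) \<le> (\<Sum>j\<in>I. \<eta> j \<bullet> x j)"
    by (simp add: sum.distrib sum_subtractf reindex[of \<psi>] reindex[of "\<lambda>j. \<eta> j \<bullet> x j"])
  \<comment> \<open>In this expansion the two squared norms have the same sums before and after
    permuting; only the cross term remains to be compared.\<close>
  moreover have "(norm (u - w))\<^sup>2 = u \<bullet> u - 2 * (u \<bullet> w) + w \<bullet> w" for u w :: 'a
    by (simp add: power2_norm_eq_inner inner_diff inner_commute algebra_simps)
  ultimately show ?thesis
    by (simp add: sum.distrib sum_subtractf reindex[of "\<lambda>j. \<eta> j \<bullet> \<eta> j"] flip: sum_distrib_left)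
qed

theorem proposition4:
  fixes \<Omega> \<Lambda> :: "(real^'n) set"
    and f g :: "real^'n \<Rightarrow> real"
    and \<alpha> \<epsilon> :: real
    and N M :: nat
    and x \<eta> :: "nat \<Rightarrow> real^'n"
    and S :: "nat \<Rightarrow> (real^'n) set"
    and v :: "nat \<Rightarrow> 'n option \<Rightarrow> nat"
    and \<psi> :: "nat \<Rightarrow> real"
    and T :: "real^'n \<Rightarrow> real^'n"
  assumes "bounded \<Omega>" and "open \<Omega>"
    and "bounded \<Lambda>" and "open \<Lambda>" and "convex \<Lambda>"
    and "0 < \<alpha>" and "\<alpha> \<le> 1"
    and "holder_continuous_on \<alpha> (closure \<Omega>) f"
    and "holder_continuous_on \<alpha> (closure \<Lambda>) g"
    and "bounded_away_zero_infinity_on (closure \<Omega>) f"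
    and "bounded_away_zero_infinity_on (closure \<Lambda>) g"
    and "(LINT p:\<Omega>|lebesgue. f p) = (LINT p:\<Lambda>|lebesgue. g p)"
    and "almost_triangulation \<epsilon> \<Omega> N x M S"
    and "vertex_labelling N x M S v"
    and "LDMAOP_solution f g \<Lambda> N x M S v \<psi> \<eta> \<or> DMAOP_solution f g \<Lambda> N x M S v \<psi> \<eta>"
    and "\<forall>j\<in>{1..N}. T (x j) = \<eta> j"
  shows "solves_quadratic_monge (dirac_sum N x) (dirac_sum N \<eta>) T \<and>
    distr (dirac_sum N x) (dirac_sum N \<eta>) T = dirac_sum N \<eta> \<and>
    (\<forall>T'. distr (dirac_sum N x) (dirac_sum N \<eta>) T' = dirac_sum N \<eta> \<longrightarrow>
      (\<Sum>j=1..N. (norm (T (x j) - x j))\<^sup>2) \<le> (\<Sum>j=1..N. (norm (T' (x j) - x j))\<^sup>2))"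
proof -
  have push: "distr (dirac_sum N x) (dirac_sum N \<eta>) T = dirac_sum N \<eta>"
  proof -
    \<comment> \<open>\<open>T (x j) = \<eta> j\<close> is known only for \<open>j\<close> in
      \<open>{1..N}\<close>; the sum defining \<open>dirac_sum\<close> sees no other index.\<close>
    have "dirac_sum N (\<lambda>j. T (x j)) = dirac_sum N \<eta>"
      using assms(16) unfolding dirac_sum_def by simp
    then show ?thesis
      by (simp add: distr_dirac_sum)
  qed
  \<comment> \<open>Both problems impose this constraint, so one argument covers the two
    cases.\<close>
  have sub: "\<psi> i + \<eta> i \<bullet> (x j - x i) \<le> \<psi> j" if "i \<in> {1..N}" "j \<in> {1..N}" for i j
    using assms(15) that
    unfolding LDMAOP_solution_def LDMAOP_feasible_def DMAOP_solution_def DMAOP_feasible_def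
    by blast
  have opt: "(\<Sum>j=1..N. (norm (T (x j) - x j))\<^sup>2) \<le> (\<Sum>j=1..N. (norm (T' (x j) - x j))\<^sup>2)"
    if "distr (dirac_sum N x) (dirac_sum N \<eta>) T' = dirac_sum N \<eta>" for T'
  proof -
    obtain \<sigma> where \<sigma>: "\<sigma> permutes {1..N}" "\<And>j. j \<in> {1..N} \<Longrightarrow> T' (x j) = \<eta> (\<sigma> j)"
      using \<open>distr _ _ T' = _\<close> dirac_sum_eq_imp_permutes unfolding distr_dirac_sum by metis
    show ?thesis
      using subgradients_quadratic_cost_le[OF sub \<sigma>(1)] \<sigma>(2) assms(16) by simp
  qed
  \<comment> \<open>Against \<open>dirac_sum N x\<close> the integrals are the finite sums of
    \<open>opt\<close>, embedded in \<open>ennreal\<close>.\<close>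
  then have "(\<integral>\<^sup>+ p. ennreal ((norm (T p - p))\<^sup>2) \<partial>dirac_sum N x)
      \<le> (\<integral>\<^sup>+ p. ennreal ((norm (T' p - p))\<^sup>2) \<partial>dirac_sum N x)"
    if "distr (dirac_sum N x) (dirac_sum N \<eta>) T' = dirac_sum N \<eta>" for T'
    using that by (simp add: nn_integral_dirac_sum sum_ennreal ennreal_leI)
  then show ?thesis
    unfolding solves_quadratic_monge_def using push opt measurable_dirac_sum by blast
qed

end
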